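(* Let $k\ge1$ be an integer, let $X\subseteq\left[-\frac12,\frac12\right]^k$ be a finite set and let $E$ be a set of edges on $X$. If the family $\mathfrak{hB}_\alpha^E=\{\mathrm{hB}_\alpha^e\}_{e\in E}$ is a $t$-fold packing for some real $0\le\alpha\le\frac12$ and a positive integer $t$, then $$S_k(E)\le\frac{2t}{(2\alpha)^k}\cdot k^{k/2},$$ where for $\alpha=0$ the right-hand side is read as $+\infty$.
   Context: $\langle\cdot,\cdot\rangle$ and $|\cdot|$ are the standard dot product and Euclidean norm on $\mathbb{R}^k$, $\mathbf{0}$ is the origin. A set of edges on $X$ is a subset of the edge set of the complete graph on $X$. For an edge $e=\mathbf{a}\mathbf{b}$, put $|e|:=|\mathbf{a}-\mathbf{b}|$, $\mathbf{m}_e:=\frac{\mathbf{a}+\mathbf{b}}2$, and let $\mathrm{B}_\alpha^e:=\{\mathbf{x}\in\mathbb{R}^k:|\mathbf{x}-\mathbf{m}_e|<\alpha|e|\}$ be the open ball of radius $\alpha|e|$ centered at $\mathbf{m}_e$. The open half-ball $\mathrm{hB}_\alpha^e$ is $\{\mathbf{x}\in\mathrm{B}_\alpha^e:\langle\mathbf{x},\mathbf{m}_e\rangle<|\mathbf{m}_e|^2\}$ if $\mathbf{m}_e\ne\mathbf{0}$, and $\{\mathbf{x}\in\mathrm{B}_\alpha^e: x_1<0\}$ if $\mathbf{m}_e=\mathbf{0}$. $S_k(E):=\sum_{e\in E}|e|^k$. An indexed family $\{A_i\}_{i\in I}$ of subsets of $\mathbb{R}^k$, each of finite volume, is a $t$-fold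 packing ($t$ a positive integer) if each point of $\mathbb{R}^k$ belongs to the interior of $A_i$ for at most $t$ indices $i\in I$. *)

theory Defs
  imports "HOL-Analysis.Analysis"
begin

definition complete_graph_edges :: "'a set \<Rightarrow> 'a set set" where
  "complete_graph_edges X = {e. \<exists>a\<in>X. \<exists>b\<in>X. a \<noteq> b \<and> e = {a, b}}"

text \<open>
  Edges are unordered pairs, so length and midpoint are defined by description over the
  possible orderings of the end points; the two lemmas below show that they do not depend
  on the ordering.
\<close>

definition edge_length :: "'a::metric_space set \<Rightarrow> real" where
  "edge_length e = (THE r. \<exists>a b. e = {a, b} \<and> r = dist a b)"

definition edge_midpoint :: "'a::real_vector set \<Rightarrow> 'a" where
  "edge_midpoint e = (THE m. \<exists>a b. e = {a, b} \<and> m = midpoint a b)"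

lemma edge_length_doubleton: "edge_length {a, b} = dist a b"
  unfolding edge_length_def
  by (rule the_equality) (auto simp: doubleton_eq_iff dist_commute)

lemma edge_midpoint_doubleton: "edge_midpoint {a, b} = midpoint a b"
  unfolding edge_midpoint_def
  by (rule the_equality) (auto simp: doubleton_eq_iff midpoint_sym)

definition edge_ball :: "real \<Rightarrow> (real ^ 'n) set \<Rightarrow> (real ^ 'n) set" where
  "edge_ball \<alpha> e = ball (edge_midpoint e) (\<alpha> * edge_length e)"

text \<open>
  A finite index type carries no preferred first element, so the index \<open>i\<^sub>1\<close> of the
  coordinate \<open>x\<^sub>1\<close> is a parameter; it only matters for edges centred at the origin.
\<close>

definition edge_half_ball :: "'n \<Rightarrow> real \<Rightarrow> (real ^ 'n) set \<Rightarrow> (real ^ 'n::finite) set" where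
  "edge_half_ball i\<^sub>1 \<alpha> e =
    (if edge_midpoint e \<noteq> 0
     then {x \<in> edge_ball \<alpha> e. x \<bullet> edge_midpoint e < (norm (edge_midpoint e))\<^sup>2}
     else {x \<in> edge_ball \<alpha> e. x $ i\<^sub>1 < 0})"

definition edge_power_sum :: "nat \<Rightarrow> 'a::metric_space set set \<Rightarrow> real" where
  "edge_power_sum k E = (\<Sum>e\<in>E. edge_length e ^ k)"

text \<open>
  Finiteness of the index set is required separately because \<^term>\<open>card\<close> is \<open>0\<close> on
  infinite sets.
\<close>

definition fold_packing :: "nat \<Rightarrow> 'i set \<Rightarrow> ('i \<Rightarrow> 'a::euclidean_space set) \<Rightarrow> bool" where
  "fold_packing t I A \<longleftrightarrow>
    (\<forall>i\<in>I. A i \<in> lmeasurable) \<and>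
    (\<forall>x. finite {i \<in> I. x \<in> interior (A i)} \<and> card {i \<in> I. x \<in> interior (A i)} \<le> t)"

end

(*
  A half-ball occupies half of the volume of its ball, and every half-ball lies in the ball of
  radius sqrt k / 2 about the origin: for an edge e = ab of midpoint m the parallelogram law gives
  |m|^2 + (|e| / 2)^2 = (|a|^2 + |b|^2) / 2 <= k / 4, while <x, m> <= |m|^2 yields
  |x|^2 <= |x - m|^2 + |m|^2. Comparing volumes in a t-fold packing, the volume of the unit ball
  cancels.
*)
theory Submission
  imports Defs
begin

text \<open>Double counting by integration: the sum of the indicator functions at a point is the
  number of sets containing it, at most \<open>t\<close> on \<open>B\<close> and zero elsewhere.
  Openness turns the interiors of the packing condition into the sets themselves.\<close>

lemma sum_measure_fold_packing_le:
  fixes A :: "'i \<Rightarrow> 'a::euclidean_space set"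
  assumes "finite I" and pack: "fold_packing t I A"
    and "\<And>i. i \<in> I \<Longrightarrow> open (A i)" and sub: "\<And>i. i \<in> I \<Longrightarrow> A i \<subseteq> B"
    and B: "B \<in> lmeasurable"
  shows "(\<Sum>i\<in>I. measure lebesgue (A i)) \<le> real t * measure lebesgue B"
proof -
  have A: "A i \<in> lmeasurable" if "i \<in> I" for i
    using pack that by (auto simp: fold_packing_def)
  have le: "(\<Sum>i\<in>I. indicat_real (A i) x) \<le> real t * indicat_real B x" for x
  proof -
    have eq: "{i \<in> I. x \<in> interior (A i)} = {i \<in> I. x \<in> A i}"
      using assms(3) by (auto simp: interior_open)
    have "(\<Sum>i\<in>I. indicat_real (A i) x) = real (card {i \<in> I. x \<in> A i})"
      using \<open>finite I\<close> by (simp add: indicator_def of_bool_def sum.If_cases Int_def)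
    also have "\<dots> \<le> real t * indicat_real B x"
    proof (cases "x \<in> B")
      case True
      then show ?thesis
        using pack unfolding fold_packing_def by (simp flip: eq)
    next
      case False
      then have empty: "{i \<in> I. x \<in> A i} = {}"
        using sub by auto
      show ?thesis
        unfolding empty by simp
    qed
    finally show ?thesis .
  qed
  have "(\<Sum>i\<in>I. measure lebesgue (A i)) = (\<Sum>i\<in>I. \<integral>x. indicat_real (A i) x \<partial>lebesgue)"
    by simp
  also have "\<dots> = (\<integral>x. (\<Sum>i\<in>I. indicat_real (A i) x) \<partial>lebesgue)"
    using A by (intro Bochner_Integration.integral_sum [symmetric])
      (simp add: lmeasurable_iff_integrable)
  also have "\<dots> \<le> (\<integral>x. real t * indicat_real B x \<partial>lebesgue)"
    using A B le
    by (intro integral_mono Bochner_Integration.integrable_sum integrable_mult_right)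
       (auto simp: lmeasurable_iff_integrable)
  also have "\<dots> = real t * measure lebesgue B"
    by simp
  finally show ?thesis .
qed

text \<open>The reflection of space through the centre \<open>m\<close> preserves volume and
  exchanges the two open halves of the ball, while the cutting hyperplane is a null set. So one half
  carries at least half of the volume.\<close>

lemma measure_half_ball_ge:
  fixes m v :: "'a::euclidean_space"
  assumes "v \<noteq> 0" "0 \<le> r"
  shows "unit_ball_vol (DIM('a)) * r ^ DIM('a)
    \<le> 2 * measure lebesgue (ball m r \<inter> {x. v \<bullet> x < v \<bullet> m})"
proof -
  let ?L = "ball m r \<inter> {x. v \<bullet> x < v \<bullet> m}"
  \<comment> \<open>The reflection is written as an affine map so that
    \<open>measure_lebesgue_affine\<close> applies; its volume factor is a power of |-1| =
    1.\<close>
  let ?R = "(\<lambda>x. (-1) *\<^sub>R x + 2 *\<^sub>R m) ` ?L"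
  let ?H = "ball m r \<inter> {x. v \<bullet> x = v \<bullet> m}"
  have L: "?L \<in> lmeasurable"
    by (intro lmeasurable_open) (auto simp: open_halfspace_lt bounded_Int)
  have R: "?R \<in> lmeasurable"
  proof -
    \<comment> \<open>Measurability comes from recognising the image as the opposite open half. The
      reflection is an involution, so the preimage of \<open>y\<close> is its own reflection
      \<open>2 *\<^sub>R m - y\<close>.\<close>
    have "?R = ball m r \<inter> {x. v \<bullet> m < v \<bullet> x}"
    proof (intro equalityI subsetI)
      fix y assume "y \<in> ball m r \<inter> {x. v \<bullet> m < v \<bullet> x}"
      then show "y \<in> ?R"
        by (intro image_eqI [of _ _ "2 *\<^sub>R m - y"])
           (auto simp: dist_norm inner_diff_right inner_add_right norm_minus_commute scaleR_2)
    qed (auto simp: dist_norm inner_diff_right inner_add_right norm_minus_commute scaleR_2)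
    then show ?thesis
      by (simp add: lmeasurable_open open_Int open_halfspace_gt bounded_Int)
  qed
  have "negligible {x. v \<bullet> x = v \<bullet> m}"
    using assms by (intro negligible_hyperplane) auto
  then have "negligible ?H"
    by (rule negligible_subset) auto
  then have H: "?H \<in> lmeasurable" "measure lebesgue ?H = 0"
    by (rule negligible_imp_measurable, rule negligible_imp_measure0)
  have "ball m r \<subseteq> ?L \<union> ?R \<union> ?H"
  proof
    fix y assume "y \<in> ball m r"
    moreover have "y \<in> ?R" if "y \<in> ball m r" "v \<bullet> m < v \<bullet> y"
      using that by (intro image_eqI [of _ _ "2 *\<^sub>R m - y"])
         (auto simp: dist_norm inner_diff_right inner_add_right norm_minus_commute scaleR_2)
    ultimately show "y \<in> ?L \<union> ?R \<union> ?H"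
      by (cases "v \<bullet> m" "v \<bullet> y" rule: linorder_cases) auto
  qed
  then have "measure lebesgue (ball m r) \<le> measure lebesgue (?L \<union> ?R \<union> ?H)"
    using L R H by (intro measure_mono_fmeasurable fmeasurable.Un) auto
  also have "\<dots> \<le> measure lebesgue ?L + measure lebesgue ?R + measure lebesgue ?H"
    using L R H by (smt (verit) fmeasurableD measure_Un_le sets.Un)
  also have "\<dots> = 2 * measure lebesgue ?L"
    unfolding measure_lebesgue_affine using H by simp
  finally show ?thesis
    using content_ball [OF \<open>0 \<le> r\<close>, of m] by simp
qed

text \<open>Merges the two cases of the definition: a midpoint at the origin is cut by the normal
  \<open>axis i 1\<close>, any other midpoint by itself. The last conjunct keeps the direction of
  the cut, which the containment in a ball about the origin depends on.\<close>

lemma edge_half_ball_eq: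
  "\<exists>v. v \<noteq> 0 \<and> edge_half_ball i \<alpha> {a, b} =
    ball (midpoint a b) (\<alpha> * dist a b) \<inter> {x. v \<bullet> x < v \<bullet> midpoint a b} \<and>
    (midpoint a b \<noteq> 0 \<longrightarrow> v = midpoint a b)"
proof (cases "midpoint a b = 0")
  case True
  then show ?thesis
    by (intro exI [of _ "axis i 1"])
       (auto simp: edge_half_ball_def edge_ball_def edge_midpoint_doubleton edge_length_doubleton
         inner_axis' axis_eq_0_iff)
next
  case False
  then show ?thesis
    by (intro exI [of _ "midpoint a b"])
       (auto simp: edge_half_ball_def edge_ball_def edge_midpoint_doubleton edge_length_doubleton
         power2_norm_eq_inner inner_commute)
qed

lemma edge_half_ball_subset:
  assumes a: "norm a \<le> R" and b: "norm b \<le> R" and \<alpha>: "0 \<le> \<alpha>" "\<alpha> \<le> 1/2"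
  shows "edge_half_ball i \<alpha> {a, b} \<subseteq> ball 0 R"
proof
  fix x assume x: "x \<in> edge_half_ball i \<alpha> {a, b}"
  define m where "m = midpoint a b"
  obtain v where v: "edge_half_ball i \<alpha> {a, b} = ball m (\<alpha> * dist a b) \<inter> {x. v \<bullet> x < v \<bullet> m}"
    "m \<noteq> 0 \<longrightarrow> v = m"
    using edge_half_ball_eq [of i \<alpha> a b] unfolding m_def by blast
  \<comment> \<open>For \<open>m = 0\<close> both sides vanish, so the arbitrary direction of the
    cut does no harm.\<close>
  have inner: "m \<bullet> x \<le> m \<bullet> m"
    using v x by (cases "m = 0") auto
  have "norm (x - m) < \<alpha> * dist a b"
    using v x by (simp add: dist_norm norm_minus_commute)
  also have "\<dots> \<le> 1/2 * dist a b"
    using \<alpha> by (intro mult_right_mono) auto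
  finally have "(norm (x - m))\<^sup>2 < (1/2 * dist a b)\<^sup>2"
    by (intro power_strict_mono) auto
  then have near: "(x - m) \<bullet> (x - m) < (a - b) \<bullet> (a - b) / 4"
    by (simp add: power2_norm_eq_inner [symmetric] dist_norm power_divide)
  \<comment> \<open>Parallelogram law for \<open>a\<close> and \<open>b\<close>, divided by
    4.\<close>
  have "m \<bullet> m = (a + b) \<bullet> (a + b) / 4"
    by (simp add: m_def midpoint_def)
  also have "\<dots> = (a \<bullet> a + b \<bullet> b) / 2 - (a - b) \<bullet> (a - b) / 4"
    by (simp add: inner_add_left inner_add_right inner_diff_left inner_diff_right
        inner_commute [of b a] field_simps)
  finally have m: "m \<bullet> m = (a \<bullet> a + b \<bullet> b) / 2 - (a - b) \<bullet> (a - b) / 4" .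
  have ab: "a \<bullet> a \<le> R\<^sup>2" "b \<bullet> b \<le> R\<^sup>2"
    using a b by (auto simp: power2_norm_eq_inner [symmetric] intro: power_mono)
  \<comment> \<open>Expansion of the square of x = (x - m) + m. The term |e|^2/4 that bounds |x -
    m|^2 is exactly what the parallelogram law subtracts in |m|^2, so only the mean of |a|^2 and
    |b|^2 remains.\<close>
  have "x \<bullet> x = (x - m) \<bullet> (x - m) + 2 * (m \<bullet> x) - m \<bullet> m"
    by (simp add: inner_diff_left inner_diff_right inner_commute [of x m])
  also have "\<dots> < (a - b) \<bullet> (a - b) / 4 + m \<bullet> m"
    using near inner by argo
  also have "\<dots> \<le> R\<^sup>2"
    using m ab by argo
  finally have "x \<bullet> x < R\<^sup>2" .
  moreover have "0 \<le> R"
    using a norm_ge_zero [of a] by linarith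
  ultimately show "x \<in> ball 0 R"
    by (simp add: power2_norm_eq_inner [symmetric] power2_less_imp_less)
qed

lemma norm_le_of_mem_unit_cube:
  fixes x :: "real ^ 'n"
  assumes "\<forall>i. x $ i \<in> {-1/2..1/2}"
  shows "norm x \<le> sqrt (real CARD('n)) / 2"
proof -
  have "(x $ i)\<^sup>2 \<le> (1/2)\<^sup>2" for i
    using assms [rule_format, of i] by (intro power2_le_iff_abs_le [THEN iffD2]) auto
  then have "(\<Sum>i\<in>UNIV. (x $ i)\<^sup>2) \<le> (\<Sum>i\<in>(UNIV :: 'n set). 1/4)"
    by (intro sum_mono) (simp add: power_divide)
  then have "norm x \<le> sqrt (real CARD('n) / 4)"
    by (simp add: norm_vec_def L2_set_def)
  then show ?thesis
    by (simp add: real_sqrt_divide)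
qed

text \<open>The volume comparison for vertices in any origin-centred ball of radius
  \<open>R\<close>. Keeping the power of \<alpha> on the left avoids a division, so \<alpha> = 0
  needs no separate treatment here.\<close>

lemma edge_power_sum_le_of_fold_packing:
  fixes E :: "(real ^ 'n::finite) set set"
  assumes "finite X" and X: "\<And>x. x \<in> X \<Longrightarrow> norm x \<le> R" and "0 \<le> R"
    and E: "E \<subseteq> complete_graph_edges X"
    and \<alpha>: "0 \<le> \<alpha>" "\<alpha> \<le> 1/2"
    and pack: "fold_packing t E (edge_half_ball i \<alpha>)"
  shows "\<alpha> ^ CARD('n) * edge_power_sum CARD('n) E \<le> 2 * real t * R ^ CARD('n)"
proof -
  let ?h = "edge_half_ball i \<alpha>"
  let ?V = "unit_ball_vol (CARD('n))"
  have "E \<subseteq> Pow X"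
    using E by (auto simp: complete_graph_edges_def)
  then have "finite E"
    using \<open>finite X\<close> by (meson finite_Pow_iff finite_subset)
  have edge: "\<exists>a\<in>X. \<exists>b\<in>X. e = {a, b}" if "e \<in> E" for e
    using E that unfolding complete_graph_edges_def by blast
  have "open (?h e)" if "e \<in> E" for e
  proof -
    obtain a b where e: "e = {a, b}"
      using edge [OF \<open>e \<in> E\<close>] by blast
    obtain v where "?h e = ball (midpoint a b) (\<alpha> * dist a b) \<inter> {x. v \<bullet> x < v \<bullet> midpoint a b}"
      using edge_half_ball_eq [of i \<alpha> a b] e by blast
    then show ?thesis
      by (simp add: open_Int open_halfspace_lt)
  qed
  moreover have "?h e \<subseteq> ball 0 R" if "e \<in> E" for e
    using edge [OF that] edge_half_ball_subset X \<alpha> by blast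
  ultimately have sum_le: "(\<Sum>e\<in>E. measure lebesgue (?h e)) \<le> real t * (?V * R ^ CARD('n))"
    using sum_measure_fold_packing_le [OF \<open>finite E\<close> pack, of "ball 0 R"]
      content_ball [OF \<open>0 \<le> R\<close>, of "0 :: real ^ 'n"] by simp
  \<comment> \<open>The left side is the volume of the full ball around the midpoint of
    \<open>e\<close>.\<close>
  have "?V * (\<alpha> * edge_length e) ^ CARD('n) \<le> 2 * measure lebesgue (?h e)" if "e \<in> E" for e
  proof -
    obtain a b where e: "e = {a, b}"
      using edge [OF \<open>e \<in> E\<close>] by blast
    obtain v where "v \<noteq> 0"
      "?h e = ball (midpoint a b) (\<alpha> * dist a b) \<inter> {x. v \<bullet> x < v \<bullet> midpoint a b}"
      using edge_half_ball_eq [of i \<alpha> a b] e by blast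
    then show ?thesis
      using measure_half_ball_ge [of v "\<alpha> * dist a b" "midpoint a b"] \<alpha> e
      by (simp add: edge_length_doubleton)
  qed
  then have "(\<Sum>e\<in>E. ?V * (\<alpha> * edge_length e) ^ CARD('n))
      \<le> (\<Sum>e\<in>E. 2 * measure lebesgue (?h e))"
    by (rule sum_mono)
  then have "?V * (\<alpha> ^ CARD('n) * edge_power_sum CARD('n) E)
      \<le> 2 * (\<Sum>e\<in>E. measure lebesgue (?h e))"
    by (simp add: edge_power_sum_def power_mult_distrib sum_distrib_left)
  also have "\<dots> \<le> ?V * (2 * real t * R ^ CARD('n))"
    using sum_le by (simp add: mult_ac)
  \<comment> \<open>The unit ball has positive volume, so the factor \<open>?V\<close>
    cancels.\<close>
  finally show ?thesis
    by (simp add: unit_ball_vol_pos)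
qed

theorem lemma2p3:
  fixes X :: "(real ^ 'n::finite) set"
    and E :: "(real ^ 'n) set set"
    and i\<^sub>1 :: 'n
    and \<alpha> :: real
    and t :: nat
  assumes "finite X"
    and "X \<subseteq> {x. \<forall>i. x $ i \<in> {-1/2..1/2}}"
    and "E \<subseteq> complete_graph_edges X"
    and "0 \<le> \<alpha>" and "\<alpha> \<le> 1/2"
    and "0 < t"
    and "fold_packing t E (edge_half_ball i\<^sub>1 \<alpha>)"
  shows "ereal (edge_power_sum CARD('n) E) \<le>
    (if \<alpha> = 0 then \<infinity>
     else ereal (2 * real t / (2 * \<alpha>) ^ CARD('n) * real CARD('n) powr (real CARD('n) / 2)))"
proof (cases "\<alpha> = 0")
  case False
  let ?k = "CARD('n)"
  \<comment> \<open>Half the diagonal of the cube serves as the radius \<open>R\<close>.\<close>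
  have "norm x \<le> sqrt (real ?k) / 2" if "x \<in> X" for x
    using assms(2) that by (intro norm_le_of_mem_unit_cube) auto
  then have "\<alpha> ^ ?k * edge_power_sum ?k E \<le> 2 * real t * (sqrt (real ?k) / 2) ^ ?k"
    using assms by (intro edge_power_sum_le_of_fold_packing [of X]) auto
  \<comment> \<open>The k-th power of the radius is k^(k/2) / 2^k, and this 2^k joins \<alpha>^k to
    form the denominator (2\<alpha>)^k.\<close>
  moreover have "real ?k powr (real ?k / 2) = sqrt (real ?k) ^ ?k"
    by (simp add: powr_half_sqrt [symmetric] powr_realpow [symmetric] powr_powr)
  ultimately show ?thesis
    using False \<open>0 \<le> \<alpha>\<close> by (simp add: field_simps power_mult_distrib power_divide)
qed simp

end
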